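(* Let $\mathcal{G}$ be a finite convex geometry with $cdim=2$ that, as a lattice, has at least two atoms and at least two coatoms, and let $\mathcal{M}$ be a maximal sublattice of $\mathcal{G}$. Then for every $a\in\mathcal{G}\setminus\mathcal{M}$ there is an $m\in\mathcal{M}$ with $m\prec a$.
   Context: Convex geometry generated by chains: let $X$ be a finite set and let $<_1,\dots,<_n$ be linear orders on $X$. For each $i$, let $C_i$ be the chain of all initial segments (down-sets) of $(X,<_i)$, from $\emptyset$ to $X$. The set $\mathcal{G}$ of all intersections of members of the chains $C_1,\dots,C_n$, ordered by inclusion, is a lattice, called the convex geometry generated by $C_1,\dots,C_n$; its $cdim$ is the minimum number of chains needed to generate it in this way. A maximal sublattice is a proper (nonempty) sublattice not contained in any other proper sublattice. $m\prec a$ means that $a$ covers $m$ in $\mathcal{G}$: $m<a$ and no $c\in\mathcal{G}$ satisfies $m<c<a$. Atoms are the covers of the least element, coatoms the subcovers of the greatest element. *)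

theory Defs
  imports "HOL-Algebra.Lattice"
begin

text \<open>
  Linear orders are taken reflexive, as in \<^const>\<open>linear_order_on\<close>; a strict order and its
  reflexive closure have the same initial segments.
\<close>

definition initial_segments :: "'a set \<Rightarrow> 'a rel \<Rightarrow> 'a set set" where
  "initial_segments X r = {D. D \<subseteq> X \<and> (\<forall>y\<in>D. \<forall>x\<in>X. (x, y) \<in> r \<longrightarrow> x \<in> D)}"

text \<open>
  The family \<open>F\<close> must be nonempty because \<open>\<Inter>{}\<close> is the universe of the type; nothing is
  lost, since \<open>X\<close> is itself an initial segment.
\<close>

definition generated_geometry :: "'a set \<Rightarrow> nat \<Rightarrow> (nat \<Rightarrow> 'a rel) \<Rightarrow> 'a set set" where
  "generated_geometry X n R =
     {\<Inter>F |F. F \<noteq> {} \<and> F \<subseteq> (\<Union>i<n. initial_segments X (R i))}"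

definition generated_by_chains :: "'a set \<Rightarrow> 'a set set \<Rightarrow> nat \<Rightarrow> bool" where
  "generated_by_chains X G n \<longleftrightarrow>
     n > 0 \<and> (\<exists>R. (\<forall>i<n. linear_order_on X (R i)) \<and> G = generated_geometry X n R)"

definition finite_convex_geometry :: "'a set \<Rightarrow> 'a set set \<Rightarrow> bool" where
  "finite_convex_geometry X G \<longleftrightarrow> finite X \<and> (\<exists>n. generated_by_chains X G n)"

definition cdim :: "'a set \<Rightarrow> 'a set set \<Rightarrow> nat" where
  "cdim X G = (LEAST n. generated_by_chains X G n)"

text \<open>
  Meet, join, least and greatest element below are those of the poset \<open>G\<close>; in particular
  the join of two members of \<open>G\<close> is in general larger than their union.
\<close>

definition inclusion_lattice :: "'a set set \<Rightarrow> 'a set gorder" where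
  "inclusion_lattice G = \<lparr>carrier = G, eq = (=), le = (\<subseteq>)\<rparr>"

definition covered_by :: "('a, 'b) gorder_scheme \<Rightarrow> 'a \<Rightarrow> 'a \<Rightarrow> bool" where
  "covered_by L m a \<longleftrightarrow>
     m \<in> carrier L \<and> a \<in> carrier L \<and> m \<sqsubset>\<^bsub>L\<^esub> a \<and>
     \<not> (\<exists>c\<in>carrier L. m \<sqsubset>\<^bsub>L\<^esub> c \<and> c \<sqsubset>\<^bsub>L\<^esub> a)"

definition atoms :: "('a, 'b) gorder_scheme \<Rightarrow> 'a set" where
  "atoms L = {x. covered_by L \<bottom>\<^bsub>L\<^esub> x}"

definition coatoms :: "('a, 'b) gorder_scheme \<Rightarrow> 'a set" where
  "coatoms L = {x. covered_by L x \<top>\<^bsub>L\<^esub>}"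

definition sublattice :: "('a, 'b) gorder_scheme \<Rightarrow> 'a set \<Rightarrow> bool" where
  "sublattice L S \<longleftrightarrow>
     S \<noteq> {} \<and> S \<subseteq> carrier L \<and>
     (\<forall>x\<in>S. \<forall>y\<in>S. x \<sqinter>\<^bsub>L\<^esub> y \<in> S \<and> x \<squnion>\<^bsub>L\<^esub> y \<in> S)"

definition maximal_sublattice :: "('a, 'b) gorder_scheme \<Rightarrow> 'a set \<Rightarrow> bool" where
  "maximal_sublattice L M \<longleftrightarrow>
     sublattice L M \<and> M \<noteq> carrier L \<and>
     \<not> (\<exists>S. sublattice L S \<and> S \<noteq> carrier L \<and> M \<subset> S)"

end

theory Submission
  imports Defs
begin

text \<open>
  A set is a member of the geometry iff it is closed under \<open>hull S\<close>, the elements lying below some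
  member of \<open>S\<close> in the first order and below some member of \<open>S\<close> in the second. A proper sublattice
  \<open>M\<close> satisfies an implication ``\<open>u \<in> m\<close> forces \<open>q \<in> m\<close>'' with \<open>q \<notin> hull {u}\<close>. Choose such a \<open>u\<close>
  as large as possible. Comparing \<open>u\<close> with its immediate successors in the two orders, one finds
  that the closed sets in which \<open>u\<close> is not the largest element for the first order (or for the
  second, or for either) form a proper sublattice containing \<open>M\<close>, hence equal to \<open>M\<close>. So every
  \<open>a \<notin> M\<close> has \<open>u\<close> as an extreme point, and \<open>a - {u}\<close> is a lower cover of \<open>a\<close> lying in \<open>M\<close>.
\<close>

section \<open>Extremal elements of finite linear orders\<close>

lemma linear_order_on_finite_has_least:
  assumes "linear_order_on X r" "finite T" "T \<noteq> {}" "T \<subseteq> X"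
  shows "\<exists>m\<in>T. \<forall>z\<in>T. (m, z) \<in> r"
  using assms(2-4)
proof (induction T rule: finite_ne_induct)
  case (singleton x)
  then show ?case
    using assms(1) by (auto simp: order_on_defs refl_on_def)
next
  case (insert x F)
  then obtain m where m: "m \<in> F" "\<forall>z\<in>F. (m, z) \<in> r"
    by auto
  have "x \<in> X" "m \<in> X" "x \<noteq> m"
    using insert.prems insert.hyps m(1) by auto
  then have "(x, m) \<in> r \<or> (m, x) \<in> r" and "(x, x) \<in> r"
    using assms(1) by (auto simp only: order_on_defs refl_on_def total_on_def)
  moreover have "trans r"
    using assms(1) by (auto simp: order_on_defs)
  ultimately show ?case
    using m by (metis insert_iff transD)
qed

lemma linear_order_on_finite_has_greatest:
  assumes "linear_order_on X r" "finite T" "T \<noteq> {}" "T \<subseteq> X"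
  shows "\<exists>m\<in>T. \<forall>z\<in>T. (z, m) \<in> r"
  using linear_order_on_finite_has_least[of X "r\<inverse>" T] assms by simp

section \<open>Closed sets of a pair of linear orders\<close>

locale two_orders =
  fixes X :: "'a set" and r s :: "'a rel"
  assumes finite_X: "finite X"
    and linear_r: "linear_order_on X r"
    and linear_s: "linear_order_on X s"
begin

text \<open>The setting is symmetric in the two orders; this instance transfers facts about
  \<open>r\<close> to \<open>s\<close>.\<close>

lemma swap: "two_orders X s r"
  using finite_X linear_r linear_s by unfold_locales

lemma refl_r: "x \<in> X \<Longrightarrow> (x, x) \<in> r"
  using linear_r by (auto simp: order_on_defs refl_on_def)

lemma trans_r: "(x, y) \<in> r \<Longrightarrow> (y, z) \<in> r \<Longrightarrow> (x, z) \<in> r"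
  using linear_r by (auto simp: order_on_defs dest: transD)

lemma antisym_r: "(x, y) \<in> r \<Longrightarrow> (y, x) \<in> r \<Longrightarrow> x = y"
  using linear_r by (auto simp: order_on_defs dest: antisymD)

lemma total_r: "x \<in> X \<Longrightarrow> y \<in> X \<Longrightarrow> (x, y) \<in> r \<or> (y, x) \<in> r"
  using linear_r refl_r by (cases "x = y") (simp_all add: order_on_defs total_on_def)

lemmas refl_s = two_orders.refl_r[OF swap]
  and trans_s = two_orders.trans_r[OF swap]
  and antisym_s = two_orders.antisym_r[OF swap]
  and total_s = two_orders.total_r[OF swap]

definition hull :: "'a set \<Rightarrow> 'a set" where
  "hull S = {z \<in> X. (\<exists>p\<in>S. (z, p) \<in> r) \<and> (\<exists>q\<in>S. (z, q) \<in> s)}"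

definition closed_sets :: "'a set set" where
  "closed_sets = {x. x \<subseteq> X \<and> hull x \<subseteq> x}"

text \<open>
  A nonempty closed set is determined by its two coordinates, the largest elements for the two
  orders; \<open>row\<close> and \<open>col\<close> fix one of them.
\<close>

definition row :: "'a \<Rightarrow> 'a set set" where
  "row u = {x. u \<in> x \<and> (\<forall>z\<in>x. (z, u) \<in> r)}"

definition col :: "'a \<Rightarrow> 'a set set" where
  "col u = {x. u \<in> x \<and> (\<forall>z\<in>x. (z, u) \<in> s)}"

lemma hull_swap: "two_orders.hull X s r = hull"
  unfolding fun_eq_iff two_orders.hull_def[OF swap] hull_def by auto

lemma closed_sets_swap: "two_orders.closed_sets X s r = closed_sets"
  unfolding two_orders.closed_sets_def[OF swap] closed_sets_def hull_swap ..

lemma row_swap: "two_orders.row s = col"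
  unfolding fun_eq_iff two_orders.row_def[OF swap] col_def by simp

lemma closed_subset: "x \<in> closed_sets \<Longrightarrow> x \<subseteq> X"
  by (auto simp: closed_sets_def)

lemma closedD:
  "x \<in> closed_sets \<Longrightarrow> z \<in> X \<Longrightarrow> p \<in> x \<Longrightarrow> (z, p) \<in> r \<Longrightarrow> q \<in> x \<Longrightarrow> (z, q) \<in> s \<Longrightarrow> z \<in> x"
  by (auto simp: closed_sets_def hull_def)

lemma subset_hull: "S \<subseteq> X \<Longrightarrow> S \<subseteq> hull S"
  by (auto simp: hull_def intro: refl_r refl_s)

lemma hull_least: "x \<in> closed_sets \<Longrightarrow> S \<subseteq> x \<Longrightarrow> hull S \<subseteq> x"
  unfolding closed_sets_def hull_def by blast

lemma hull_closed: "hull S \<in> closed_sets"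
  by (auto simp: closed_sets_def hull_def intro: trans_r trans_s)

lemma closed_Int: "x \<in> closed_sets \<Longrightarrow> y \<in> closed_sets \<Longrightarrow> x \<inter> y \<in> closed_sets"
  by (auto simp: closed_sets_def hull_def)

lemma closed_Inter:
  "F \<noteq> {} \<Longrightarrow> F \<subseteq> closed_sets \<Longrightarrow> \<Inter>F \<in> closed_sets"
  unfolding closed_sets_def hull_def by blast

lemma empty_closed: "{} \<in> closed_sets" and whole_closed: "X \<in> closed_sets"
  by (auto simp: closed_sets_def hull_def)

lemma initial_segment_closed: "initial_segments X r \<subseteq> closed_sets"
  by (auto simp: closed_sets_def hull_def initial_segments_def)

text \<open>Initial segments are closed and closedness survives intersection. Conversely, a closed
  set is the intersection of its down-closures in the two orders.\<close>

lemma generated_geometry_eq_closed_sets: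
  assumes "R 0 = r" "R 1 = s"
  shows "generated_geometry X 2 R = closed_sets"
proof -
  have segments: "(\<Union>i<2. initial_segments X (R i)) = initial_segments X r \<union> initial_segments X s"
    using assms by (simp add: numeral_2_eq_2 lessThan_Suc Un_commute)
  have "\<Inter>F \<in> closed_sets"
    if "F \<noteq> {}" "F \<subseteq> initial_segments X r \<union> initial_segments X s" for F
    using that initial_segment_closed two_orders.initial_segment_closed[OF swap]
    unfolding closed_sets_swap by (intro closed_Inter) auto
  moreover have "\<exists>F. x = \<Inter>F \<and> F \<noteq> {} \<and> F \<subseteq> initial_segments X r \<union> initial_segments X s"
    if x: "x \<in> closed_sets" for x
  proof -
    let ?A = "{z \<in> X. \<exists>p\<in>x. (z, p) \<in> r}" and ?B = "{z \<in> X. \<exists>p\<in>x. (z, p) \<in> s}"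
    have "x = ?A \<inter> ?B"
      using closed_subset[OF x] closedD[OF x] refl_r refl_s by blast
    moreover have "?A \<in> initial_segments X r" "?B \<in> initial_segments X s"
      by (auto simp: initial_segments_def intro: trans_r trans_s)
    ultimately show ?thesis
      by (intro exI[of _ "{?A, ?B}"]) auto
  qed
  ultimately show ?thesis
    unfolding generated_geometry_def segments by blast
qed

section \<open>Rows and columns under join and meet\<close>

lemma successor:
  assumes "u \<in> X" "q \<in> X" "(q, u) \<notin> r"
  obtains u' where "u' \<in> X" "u' \<noteq> u" "(u, u') \<in> r"
    and "\<And>z. z \<in> X \<Longrightarrow> (z, u) \<notin> r \<Longrightarrow> (u', z) \<in> r"
proof -
  let ?T = "{z \<in> X. (z, u) \<notin> r}"
  obtain u' where u': "u' \<in> ?T" "\<forall>z\<in>?T. (u', z) \<in> r"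
    using linear_order_on_finite_has_least[OF linear_r, of ?T] finite_X assms by auto
  then show thesis
    using that[of u'] assms(1) refl_r total_r by blast
qed

text \<open>Taking the hull creates no new largest element, so the \<open>r\<close>-largest element
  of a join already lies in one of the two sets. Hence the complement of a row is closed under
  joins.\<close>

lemma row_hull_Un:
  assumes "x \<subseteq> X" "y \<subseteq> X" "hull (x \<union> y) \<in> row u"
  shows "x \<in> row u \<or> y \<in> row u"
proof -
  have sub: "x \<union> y \<subseteq> hull (x \<union> y)"
    using assms by (intro subset_hull) auto
  obtain p where p: "p \<in> x \<union> y" "(u, p) \<in> r"
    using assms(3) by (auto simp: row_def hull_def)
  then have "p = u"
    using assms(3) sub antisym_r by (auto simp: row_def)
  then show ?thesis
    using p(1) sub assms(3) by (auto simp: row_def)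
qed

lemmas col_hull_Un = two_orders.row_hull_Un[OF swap, unfolded hull_swap row_swap]

text \<open>Since \<open>u'\<close> lies below \<open>u\<close> in \<open>s\<close>, a closed set
  containing \<open>u\<close> and anything beyond \<open>u\<close> in \<open>r\<close> contains
  \<open>u'\<close>. If both sets were of this kind, \<open>u'\<close> would lie in the meet and
  exceed \<open>u\<close>.\<close>

lemma row_Int:
  assumes "x \<in> closed_sets" "y \<in> closed_sets" "x \<inter> y \<in> row u"
    and u': "u' \<in> X" "u' \<noteq> u" "(u, u') \<in> r" "\<And>z. z \<in> X \<Longrightarrow> (z, u) \<notin> r \<Longrightarrow> (u', z) \<in> r"
    and "(u', u) \<in> s"
  shows "x \<in> row u \<or> y \<in> row u"
proof (rule ccontr)
  assume neither: "\<not> ?thesis"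
  have "u' \<in> w" if "w \<in> closed_sets" "u \<in> w" "w \<notin> row u" for w
  proof -
    obtain z where "z \<in> w" "(z, u) \<notin> r"
      using \<open>u \<in> w\<close> \<open>w \<notin> row u\<close> unfolding row_def by blast
    then show ?thesis
      using closedD[OF that(1) u'(1)] closed_subset[OF that(1)] u'(4) assms(8) that(2) by blast
  qed
  then have "u' \<in> x \<inter> y"
    using assms(1-3) neither by (auto simp: row_def)
  then show False
    using assms(3) u'(2,3) antisym_r by (auto simp: row_def)
qed

text \<open>Here \<open>u'\<close> succeeds \<open>u\<close> in both orders, so a closed set forced
  to contain it must go beyond \<open>u\<close> in both. This is why row and column have to be
  removed together.\<close>

lemma twin_Int:
  assumes "x \<in> closed_sets" "y \<in> closed_sets" "x \<inter> y \<in> row u \<union> col u"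
    and u': "u' \<in> X" "u' \<noteq> u" "(u, u') \<in> r" "(u, u') \<in> s"
      "\<And>z. z \<in> X \<Longrightarrow> (z, u) \<notin> r \<Longrightarrow> (u', z) \<in> r"
      "\<And>z. z \<in> X \<Longrightarrow> (z, u) \<notin> s \<Longrightarrow> (u', z) \<in> s"
  shows "x \<in> row u \<union> col u \<or> y \<in> row u \<union> col u"
proof (rule ccontr)
  assume neither: "\<not> ?thesis"
  have "u' \<in> w" if "w \<in> closed_sets" "u \<in> w" "w \<notin> row u \<union> col u" for w
  proof -
    obtain p q where "p \<in> w" "(p, u) \<notin> r" "q \<in> w" "(q, u) \<notin> s"
      using \<open>u \<in> w\<close> \<open>w \<notin> row u \<union> col u\<close> unfolding row_def col_def by blast
    then show ?thesis
      using closedD[OF that(1) u'(1)] closed_subset[OF that(1)] u'(5,6) by blast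
  qed
  then have "u' \<in> x \<inter> y"
    using assms(1-3) neither by (auto simp: row_def col_def)
  then show False
    using assms(3) u'(2-4) antisym_r antisym_s by (auto simp: row_def col_def)
qed

section \<open>The lattice of closed sets\<close>

abbreviation "L \<equiv> inclusion_lattice closed_sets"

lemma partial_order_L: "partial_order L"
  by unfold_locales (auto simp: inclusion_lattice_def)

lemma carrier_L: "carrier L = closed_sets"
  by (simp add: inclusion_lattice_def)

lemma covered_by_L:
  "covered_by L m a \<longleftrightarrow> m \<in> closed_sets \<and> a \<in> closed_sets \<and> m \<subset> a \<and>
     \<not> (\<exists>c\<in>closed_sets. m \<subset> c \<and> c \<subset> a)"
  by (auto simp: covered_by_def inclusion_lattice_def lless_def)

lemma join_L:
  assumes "x \<in> closed_sets" "y \<in> closed_sets"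
  shows "x \<squnion>\<^bsub>L\<^esub> y = hull (x \<union> y)"
proof -
  interpret partial_order L by (rule partial_order_L)
  have "least L (hull (x \<union> y)) (Upper L {x, y})"
    unfolding least_def Upper_def
    using hull_closed[of "x \<union> y"] subset_hull[of "x \<union> y"] hull_least assms closed_subset
    by (auto simp: inclusion_lattice_def)
  then show ?thesis
    \<comment> \<open>The library join is a chosen least upper bound; uniqueness identifies
      it.\<close>
    unfolding join_def sup_def by (metis (mono_tags, lifting) least_unique someI)
qed

lemma meet_L:
  assumes "x \<in> closed_sets" "y \<in> closed_sets"
  shows "x \<sqinter>\<^bsub>L\<^esub> y = x \<inter> y"
proof -
  interpret partial_order L by (rule partial_order_L)
  have "greatest L (x \<inter> y) (Lower L {x, y})"
    unfolding greatest_def Lower_def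
    using closed_Int assms by (auto simp: inclusion_lattice_def)
  then show ?thesis
    unfolding meet_def inf_def by (metis (mono_tags, lifting) greatest_unique someI)
qed

lemma bottom_L: "\<bottom>\<^bsub>L\<^esub> = {}"
proof -
  interpret partial_order L by (rule partial_order_L)
  have "least L {} (carrier L)"
    using empty_closed by (auto simp: least_def inclusion_lattice_def)
  then show ?thesis
    unfolding bottom_def by (metis (mono_tags, lifting) least_unique someI)
qed

lemma top_L: "\<top>\<^bsub>L\<^esub> = X"
proof -
  interpret partial_order L by (rule partial_order_L)
  have "greatest L X (carrier L)"
    using whole_closed closed_subset by (auto simp: greatest_def inclusion_lattice_def)
  then show ?thesis
    unfolding top_def by (metis (mono_tags, lifting) greatest_unique someI)
qed

lemma sublattice_L:
  "sublattice L S \<longleftrightarrow> S \<noteq> {} \<and> S \<subseteq> closed_sets \<and>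
     (\<forall>x\<in>S. \<forall>y\<in>S. x \<inter> y \<in> S \<and> hull (x \<union> y) \<in> S)"
  unfolding sublattice_def carrier_L using meet_L join_L by (metis subsetD)

section \<open>Extreme points, atoms and coatoms\<close>

text \<open>Being strictly largest in one order, \<open>u\<close> is not in the hull of the
  remaining points.\<close>

lemma closed_remove:
  assumes "x \<in> closed_sets" "x \<in> row u \<union> col u"
  shows "x - {u} \<in> closed_sets"
  using assms antisym_r antisym_s unfolding closed_sets_def hull_def row_def col_def by blast

lemma hull_singleton_subset: "x \<in> closed_sets \<Longrightarrow> u \<in> x \<Longrightarrow> hull {u} \<subseteq> x"
  by (rule hull_least) auto

lemma self_in_hull: "u \<in> X \<Longrightarrow> u \<in> hull {u}"
  using subset_hull[of "{u}"] by auto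

lemma hull_singleton_row: "u \<in> X \<Longrightarrow> hull {u} \<in> row u \<inter> col u"
  using self_in_hull by (auto simp: row_def col_def hull_def)

text \<open>Distinct atoms meet in the empty set, and an atom contains the hull of each of its
  points.\<close>

lemma two_atoms_disjoint:
  assumes "card (atoms L) \<ge> 2"
  obtains u v where "u \<in> X" "v \<in> X" "hull {u} \<inter> hull {v} = {}"
proof -
  obtain x y where "x \<in> atoms L" "y \<in> atoms L" "x \<noteq> y"
    using assms by (auto simp: numeral_2_eq_2 card_le_Suc_iff)
  then have xy: "covered_by L {} x" "covered_by L {} y" "x \<noteq> y"
    by (auto simp: atoms_def bottom_L)
  then have "x \<inter> y = {}"
    using closed_Int unfolding covered_by_L by (metis inf.absorb_iff2 inf_le1 inf_le2 psubsetI empty_subsetI)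
  moreover have closed: "x \<in> closed_sets" "y \<in> closed_sets"
    using xy by (simp_all add: covered_by_L)
  moreover obtain u v where uv: "u \<in> x" "v \<in> y"
    using xy by (auto simp: covered_by_L)
  ultimately have "hull {u} \<inter> hull {v} = {}"
    using hull_singleton_subset by blast
  then show thesis
    using that closed uv closed_subset by blast
qed

text \<open>Otherwise every proper closed set omits \<open>u\<close> while \<open>X - {u}\<close> is
  closed, which leaves room for only one coatom.\<close>

lemma hull_singleton_not_whole:
  assumes "card (coatoms L) \<ge> 2" "u \<in> X"
  shows "hull {u} \<noteq> X"
proof
  assume whole: "hull {u} = X"
  then have closed: "X - {u} \<in> closed_sets"
    using closed_remove[OF whole_closed] hull_singleton_row[OF assms(2)] by auto
  have "x = X - {u}" if "x \<in> coatoms L" for x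
  proof -
    have x: "covered_by L x X"
      using that by (simp add: coatoms_def top_L)
    then have "u \<notin> x"
      using hull_singleton_subset whole by (auto simp: covered_by_L)
    then show ?thesis
      using x closed assms(2) by (metis covered_by_L subset_Diff_insert Diff_empty psubsetE psubsetI Diff_subset Diff_iff insertI1)
  qed
  then have "card (coatoms L) \<le> card {X - {u}}"
    by (intro card_mono) auto
  then show False
    using assms(1) by simp
qed

section \<open>Implications valid in a sublattice\<close>

definition bad_pair :: "'a set set \<Rightarrow> 'a \<Rightarrow> 'a \<Rightarrow> bool" where
  "bad_pair M u q \<longleftrightarrow> u \<in> X \<and> q \<in> X \<and> q \<notin> hull {u} \<and> (\<forall>m\<in>M. u \<in> m \<longrightarrow> q \<in> m)"

lemma bad_pair_swap: "two_orders.bad_pair X s r = bad_pair"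
  unfolding fun_eq_iff two_orders.bad_pair_def[OF swap] bad_pair_def hull_swap by simp

text \<open>A nonempty closed set is the join of the hulls of its largest elements for the two
  orders; the empty set is the meet of two disjoint hulls.\<close>

lemma sublattice_all_hulls:
  assumes M: "sublattice L M" and atoms: "card (atoms L) \<ge> 2"
    and hulls: "\<And>u. u \<in> X \<Longrightarrow> hull {u} \<in> M"
  shows "closed_sets \<subseteq> M"
proof
  fix x assume x: "x \<in> closed_sets"
  show "x \<in> M"
  proof (cases "x = {}")
    case True
    then show ?thesis
      using two_atoms_disjoint[OF atoms] hulls M unfolding sublattice_L by metis
  next
    case False
    have "finite x"
      using closed_subset[OF x] finite_X finite_subset by blast
    then obtain p q where p: "p \<in> x" "\<forall>z\<in>x. (z, p) \<in> r" and q: "q \<in> x" "\<forall>z\<in>x. (z, q) \<in> s"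
      using linear_order_on_finite_has_greatest[OF linear_r, of x]
        linear_order_on_finite_has_greatest[OF linear_s, of x] False closed_subset[OF x] by blast
    have "p \<in> hull {p}" "q \<in> hull {q}" "hull {p} \<subseteq> x" "hull {q} \<subseteq> x"
      using p(1) q(1) closed_subset[OF x] x self_in_hull hull_singleton_subset by blast+
    then have "x = hull (hull {p} \<union> hull {q})"
      using p(2) q(2) closed_subset[OF x] hull_least[OF x, of "hull {p} \<union> hull {q}"]
      by (auto simp: hull_def[of "hull {p} \<union> hull {q}"])
    then show ?thesis
      using M hulls p(1) q(1) closed_subset[OF x] unfolding sublattice_L by (metis subsetD)
  qed
qed

lemma sublattice_Inter:
  assumes "sublattice L M" "finite F" "F \<noteq> {}" "F \<subseteq> M"
  shows "\<Inter>F \<in> M"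
  using assms(2-4)
  by (induction F rule: finite_ne_induct) (use assms(1) in \<open>auto simp: sublattice_L\<close>)

lemma bad_pair_exists:
  assumes M: "sublattice L M" "M \<noteq> closed_sets"
    and atoms: "card (atoms L) \<ge> 2" and coatoms: "card (coatoms L) \<ge> 2"
  shows "\<exists>u q. bad_pair M u q"
proof -
  have sub: "M \<subseteq> closed_sets"
    using M by (simp add: sublattice_L)
  then obtain u where u: "u \<in> X" "hull {u} \<notin> M"
    using sublattice_all_hulls[OF M(1) atoms] M(2) by blast
  let ?F = "{m \<in> M. u \<in> m}"
  have "finite closed_sets"
    by (rule finite_subset[of _ "Pow X"]) (use finite_X closed_subset in auto)
  then have "finite ?F"
    using sub by (auto intro: finite_subset)
  show ?thesis
  proof (cases "?F = {}")
    \<comment> \<open>No member of \<open>M\<close> contains \<open>u\<close>, so every implication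
      from \<open>u\<close> holds vacuously.\<close>
    case True
    then show ?thesis
      using hull_singleton_not_whole[OF coatoms u(1)] closed_subset[OF hull_closed] u(1)
      unfolding bad_pair_def by blast
  next
    case False
    \<comment> \<open>\<open>I\<close> is the least member of \<open>M\<close> containing
      \<open>u\<close>; any point of it outside \<open>hull {u}\<close> serves as
      \<open>q\<close>.\<close>
    define I where "I = \<Inter>?F"
    have "I \<in> M"
      unfolding I_def using sublattice_Inter[OF M(1) \<open>finite ?F\<close>] False by auto
    moreover have "u \<in> I"
      by (simp add: I_def)
    ultimately have "hull {u} \<subset> I" "I \<subseteq> X"
      using u(2) sub closed_subset[of I] hull_singleton_subset[of I u] by auto
    then obtain q where "q \<in> I" "q \<notin> hull {u}" "q \<in> X"
      by blast
    then show ?thesis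
      using u(1) by (auto simp: bad_pair_def I_def)
  qed
qed

text \<open>
  The implication passes from \<open>u\<close> to its successor \<open>u'\<close> whenever \<open>u\<close> lies below \<open>u'\<close> in both
  orders, so for a maximal \<open>u\<close> it can only be trivial there, that is, \<open>q = u'\<close>.
\<close>

lemma bad_pair_successor:
  assumes "M \<subseteq> closed_sets" and bad: "bad_pair M u q"
    and maximal: "\<And>v p. bad_pair M v p \<Longrightarrow> (u, v) \<in> r \<Longrightarrow> (u, v) \<in> s \<Longrightarrow> v = u"
    and "(q, u) \<notin> r"
    and u': "u' \<in> X" "u' \<noteq> u" "(u, u') \<in> r" "\<And>z. z \<in> X \<Longrightarrow> (z, u) \<notin> r \<Longrightarrow> (u', z) \<in> r"
    and "(u', u) \<notin> s"
  shows "u' = q"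
proof -
  have uq: "u \<in> X" "q \<in> X"
    using bad by (auto simp: bad_pair_def)
  have us: "(u, u') \<in> s"
    using total_s uq u'(1) assms(9) by blast
  \<comment> \<open>A closed set containing \<open>u'\<close> also contains \<open>u\<close>, which
    lies below it in both orders.\<close>
  have "q \<in> m" if "m \<in> M" "u' \<in> m" for m
    using that bad closedD[of m u u' u'] u'(3) us uq assms(1) by (auto simp: bad_pair_def)
  then have "q \<in> hull {u'}"
    using maximal[of u' q] u' us uq by (auto simp: bad_pair_def)
  then show ?thesis
    using u'(4)[OF uq(2) assms(4)] antisym_r by (auto simp: hull_def)
qed

lemma bad_pair_disjoint_row:
  assumes "M \<subseteq> closed_sets" and bad: "bad_pair M u q" and "(q, u) \<notin> r" "m \<in> M"
  shows "m \<notin> row u"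
  using assms by (auto simp: bad_pair_def row_def)

section \<open>Maximal sublattices as complements of rows and columns\<close>

lemma maximal_sublattice_eq:
  assumes "maximal_sublattice L M" "sublattice L S" "S \<noteq> closed_sets" "M \<subseteq> S"
  shows "M = S"
  using assms unfolding maximal_sublattice_def carrier_L by blast

lemma maximal_sublattice_eq_row:
  assumes M: "maximal_sublattice L M" and bad: "bad_pair M u q" and q: "(q, u) \<notin> r"
    and u': "u' \<in> X" "u' \<noteq> u" "(u, u') \<in> r" "\<And>z. z \<in> X \<Longrightarrow> (z, u) \<notin> r \<Longrightarrow> (u', z) \<in> r"
    and "(u', u) \<in> s"
  shows "M = closed_sets - row u"
proof (rule maximal_sublattice_eq[OF M])
  have sub: "sublattice L M" "M \<subseteq> closed_sets" "M \<noteq> {}"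
    using M by (auto simp: maximal_sublattice_def sublattice_L)
  show "M \<subseteq> closed_sets - row u"
    using bad_pair_disjoint_row[OF sub(2) bad q] sub(2) by blast
  then show "sublattice L (closed_sets - row u)"
    unfolding sublattice_L
    using sub(3) closed_Int hull_closed row_hull_Un[OF closed_subset closed_subset]
      row_Int[OF _ _ _ u' assms(8)] by blast
  show "closed_sets - row u \<noteq> closed_sets"
    using bad hull_closed hull_singleton_row by (auto simp: bad_pair_def)
qed

text \<open>A member of \<open>M\<close> containing \<open>u\<close> contains \<open>u'\<close>,
  which is strictly larger in both orders, so it lies in neither the row nor the column of
  \<open>u\<close>.\<close>

lemma maximal_sublattice_eq_twin:
  assumes M: "maximal_sublattice L M" and bad: "bad_pair M u u'"
    and u': "u' \<in> X" "u' \<noteq> u" "(u, u') \<in> r" "(u, u') \<in> s"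
      "\<And>z. z \<in> X \<Longrightarrow> (z, u) \<notin> r \<Longrightarrow> (u', z) \<in> r"
      "\<And>z. z \<in> X \<Longrightarrow> (z, u) \<notin> s \<Longrightarrow> (u', z) \<in> s"
  shows "M = closed_sets - (row u \<union> col u)"
proof (rule maximal_sublattice_eq[OF M])
  have sub: "sublattice L M" "M \<subseteq> closed_sets" "M \<noteq> {}"
    using M by (auto simp: maximal_sublattice_def sublattice_L)
  have "m \<notin> row u \<union> col u" if "m \<in> M" for m
    using that bad antisym_r[OF _ u'(3)] antisym_s[OF _ u'(4)] u'(2)
    by (auto simp: bad_pair_def row_def col_def)
  then show "M \<subseteq> closed_sets - (row u \<union> col u)"
    using sub(2) by blast
  then show "sublattice L (closed_sets - (row u \<union> col u))"
    unfolding sublattice_L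
    using sub(3) closed_Int hull_closed row_hull_Un[OF closed_subset closed_subset]
      col_hull_Un[OF closed_subset closed_subset] twin_Int[OF _ _ _ u'] by blast
  show "closed_sets - (row u \<union> col u) \<noteq> closed_sets"
    using bad hull_closed hull_singleton_row by (auto simp: bad_pair_def)
qed

text \<open>The split is on whether the \<open>r\<close>-successor of \<open>u\<close> lies below
  \<open>u\<close> in \<open>s\<close>. The second outcome includes
  \<open>(q, u) \<notin> s\<close>, which is what the mirrored version takes as hypothesis.\<close>

lemma bad_pair_maximal_cases:
  assumes M: "maximal_sublattice L M" and bad: "bad_pair M u q"
    and maximal: "\<And>v p. bad_pair M v p \<Longrightarrow> (u, v) \<in> r \<Longrightarrow> (u, v) \<in> s \<Longrightarrow> v = u"
    and q: "(q, u) \<notin> r"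
  shows "M = closed_sets - row u \<or>
    q \<noteq> u \<and> (u, q) \<in> r \<and> (q, u) \<notin> s \<and> (\<forall>z\<in>X. (z, u) \<notin> r \<longrightarrow> (q, z) \<in> r)"
proof -
  have uq: "u \<in> X" "q \<in> X" and sub: "M \<subseteq> closed_sets"
    using M bad by (auto simp: bad_pair_def maximal_sublattice_def sublattice_L)
  obtain u' where u': "u' \<in> X" "u' \<noteq> u" "(u, u') \<in> r"
    "\<And>z. z \<in> X \<Longrightarrow> (z, u) \<notin> r \<Longrightarrow> (u', z) \<in> r"
    using successor[OF uq q] by blast
  show ?thesis
  proof (cases "(u', u) \<in> s")
    case True
    then show ?thesis
      using maximal_sublattice_eq_row[OF M bad q u'] by blast
  next
    case False
    have "u' = q"
      by (rule bad_pair_successor[OF sub bad _ q u'(1-3) _ False]) (fact maximal u'(4))+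
    then show ?thesis
      using u' False by blast
  qed
qed

lemmas bad_pair_maximal_cases_swap =
  two_orders.bad_pair_maximal_cases[OF swap, unfolded bad_pair_swap closed_sets_swap row_swap]

lemma maximal_sublattice_complement:
  assumes M: "maximal_sublattice L M"
    and atoms: "card (atoms L) \<ge> 2" and coatoms: "card (coatoms L) \<ge> 2"
  shows "\<exists>u. closed_sets - M \<subseteq> row u \<union> col u"
proof -
  let ?U = "{u \<in> X. \<exists>q. bad_pair M u q}"
  have "?U \<noteq> {}"
    using bad_pair_exists[of M] M atoms coatoms
    by (auto simp: maximal_sublattice_def carrier_L bad_pair_def)
  \<comment> \<open>Greatest for \<open>r\<close> alone suffices: a bad source above
    \<open>u\<close> in both orders is in particular above it in \<open>r\<close>.\<close>
  then obtain u where u: "u \<in> ?U" "\<forall>v\<in>?U. (v, u) \<in> r"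
    using linear_order_on_finite_has_greatest[OF linear_r, of ?U] finite_X by auto
  then obtain q where bad: "bad_pair M u q"
    by auto
  have uq: "u \<in> X" "q \<in> X" "(q, u) \<notin> r \<or> (q, u) \<notin> s"
    using bad by (auto simp: bad_pair_def hull_def)
  have maximal: "v = u" if "bad_pair M v p" "(u, v) \<in> r" for v p
    using u that antisym_r by (auto simp: bad_pair_def)
  have cases_r: "M = closed_sets - row u \<or>
      q \<noteq> u \<and> (u, q) \<in> r \<and> (q, u) \<notin> s \<and> (\<forall>z\<in>X. (z, u) \<notin> r \<longrightarrow> (q, z) \<in> r)"
    if "(q, u) \<notin> r"
    using bad_pair_maximal_cases[OF M bad _ that] maximal by blast
  have cases_s: "M = closed_sets - col u \<or>
      q \<noteq> u \<and> (u, q) \<in> s \<and> (q, u) \<notin> r \<and> (\<forall>z\<in>X. (z, u) \<notin> s \<longrightarrow> (q, z) \<in> s)"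
    if "(q, u) \<notin> s"
    using bad_pair_maximal_cases_swap[OF M bad _ that] maximal by blast
  \<comment> \<open>If neither complement occurs, the failure of \<open>q\<close> below
    \<open>u\<close> in one order passes to the other, and \<open>q\<close> succeeds
    \<open>u\<close> in both.\<close>
  consider "M = closed_sets - row u" | "M = closed_sets - col u" |
    "q \<noteq> u" "(u, q) \<in> r" "(u, q) \<in> s" "\<And>z. z \<in> X \<Longrightarrow> (z, u) \<notin> r \<Longrightarrow> (q, z) \<in> r"
    "\<And>z. z \<in> X \<Longrightarrow> (z, u) \<notin> s \<Longrightarrow> (q, z) \<in> s"
    using uq(3) cases_r cases_s by blast
  then show ?thesis
  proof cases
    case 3
    then show ?thesis
      using maximal_sublattice_eq_twin[OF M bad uq(2)] by blast
  qed blast+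
qed

lemma maximal_sublattice_lower_cover:
  assumes M: "maximal_sublattice L M"
    and "card (atoms L) \<ge> 2" "card (coatoms L) \<ge> 2" and a: "a \<in> closed_sets - M"
  shows "\<exists>m\<in>M. covered_by L m a"
proof -
  obtain u where u: "closed_sets - M \<subseteq> row u \<union> col u"
    using maximal_sublattice_complement[OF assms(1-3)] by blast
  then have "u \<in> a" and closed: "a - {u} \<in> closed_sets"
    using a closed_remove by (auto simp: row_def col_def)
  \<comment> \<open>Members of a row or column of \<open>u\<close> contain \<open>u\<close>, so
    removing it leads into \<open>M\<close>.\<close>
  moreover have "a - {u} \<notin> row u \<union> col u"
    by (auto simp: row_def col_def)
  ultimately have "a - {u} \<in> M" "covered_by L (a - {u}) a"
    using u a unfolding covered_by_L by blast+
  then show ?thesis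
    by blast
qed

end

theorem corollary6p6:
  fixes X :: "'a set" and G M :: "'a set set" and a :: "'a set"
  assumes "finite_convex_geometry X G"
    and "cdim X G = 2"
    and "card (atoms (inclusion_lattice G)) \<ge> 2"
    and "card (coatoms (inclusion_lattice G)) \<ge> 2"
    and "maximal_sublattice (inclusion_lattice G) M"
    and "a \<in> G - M"
  shows "\<exists>m\<in>M. covered_by (inclusion_lattice G) m a"
proof -
  have "finite X" and "\<exists>n. generated_by_chains X G n"
    using assms(1) by (auto simp: finite_convex_geometry_def)
  from this(2) have "generated_by_chains X G 2"
    using LeastI_ex[of "generated_by_chains X G"] assms(2) by (simp add: cdim_def)
  then obtain R where R: "\<forall>i<2. linear_order_on X (R i)" "G = generated_geometry X 2 R"
    by (auto simp: generated_by_chains_def)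
  interpret two_orders X "R 0" "R 1"
    using \<open>finite X\<close> R(1) by unfold_locales auto
  have "G = closed_sets"
    using R(2) generated_geometry_eq_closed_sets by simp
  then show ?thesis
    using maximal_sublattice_lower_cover assms(3-6) by simp
qed

end
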